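(* Let $\mathcal{F}$ be a finite family of pairwise intersecting circles in the plane such that no closed disc bounded by a circle of $\mathcal{F}$ contains the closed disc bounded by another circle of $\mathcal{F}$. Let $G(\mathcal{F})$ be the geometric graph whose vertices are the centers of the circles in $\mathcal{F}$, in which two centers are joined by a red edge if the corresponding two circles create a lens in $\mathcal{A}(\mathcal{F})$, and by a blue edge if the corresponding two circles touch. Then $G(\mathcal{F})$ does not contain a pair of avoiding edges unless there are four circles $C_1,C_2,C_3,C_4\in\mathcal{F}$ passing through a common point at which $C_1$ and $C_3$ touch each other and $C_2$ and $C_4$ touch each other. Only in such a case can $G(\mathcal{F})$ contain avoiding edges, and then the avoiding edges can only be a pair of two opposite red edges of the quadrilateral whose vertices are the centers of such four circles $C_1,C_2,C_3,C_4$.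
   Context: Circles are distinct; "pairwise intersecting" means every two circles of $\mathcal{F}$ have at least one common point (touching is allowed). The arrangement $\mathcal{A}(\mathcal{F})$ consists of vertices (intersection points of circles of $\mathcal{F}$), edges (arcs of circles of $\mathcal{F}$ between consecutive vertices) and faces (connected components of the complement of the union of the circles). Two circles create a lens if some face of $\mathcal{A}(\mathcal{F})$ bounded by exactly two edges is equal to the intersection of the two discs bounded by these two circles. A geometric graph is a graph drawn in the plane with vertices as points and edges as straight-line segments. Two edges (segments) are avoiding if they are opposite edges of a convex quadrilateral. *)

theory Defs
  imports "HOL-Analysis.Analysis"
begin

text \<open>A circle is given by its centre and its radius; the radius is required to be positive
  wherever a family of circles is introduced, so that distinct pairs are distinct circles.\<close>

type_synonym circle = "(real^2) \<times> real"

abbreviation center :: "circle \<Rightarrow> real^2" where "center \<equiv> fst"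
abbreviation radius :: "circle \<Rightarrow> real" where "radius \<equiv> snd"

definition circ :: "circle \<Rightarrow> (real^2) set" where
  "circ C = sphere (center C) (radius C)"

definition open_disc :: "circle \<Rightarrow> (real^2) set" where
  "open_disc C = ball (center C) (radius C)"

definition closed_disc :: "circle \<Rightarrow> (real^2) set" where
  "closed_disc C = cball (center C) (radius C)"

definition touch_at :: "circle \<Rightarrow> circle \<Rightarrow> real^2 \<Rightarrow> bool" where
  "touch_at C D p \<longleftrightarrow> C \<noteq> D \<and> circ C \<inter> circ D = {p}"

definition touch :: "circle \<Rightarrow> circle \<Rightarrow> bool" where
  "touch C D \<longleftrightarrow> (\<exists>p. touch_at C D p)"

definition arr_vertices :: "circle set \<Rightarrow> (real^2) set" where
  "arr_vertices F = (\<Union>C\<in>F. \<Union>D\<in>F - {C}. circ C \<inter> circ D)"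

text \<open>Edges are taken without their end vertices.\<close>

definition arr_edges :: "circle set \<Rightarrow> (real^2) set set" where
  "arr_edges F = (\<Union>C\<in>F. components (circ C - arr_vertices F))"

definition arr_faces :: "circle set \<Rightarrow> (real^2) set set" where
  "arr_faces F = components (- (\<Union>C\<in>F. circ C))"

definition bounding_edges :: "circle set \<Rightarrow> (real^2) set \<Rightarrow> (real^2) set set" where
  "bounding_edges F f = {e \<in> arr_edges F. e \<subseteq> frontier f}"

text \<open>Faces are open sets, so the face is compared with the intersection of the open discs.\<close>

definition creates_lens :: "circle set \<Rightarrow> circle \<Rightarrow> circle \<Rightarrow> bool" where
  "creates_lens F C D \<longleftrightarrow>
     C \<noteq> D \<and>
     (\<exists>f \<in> arr_faces F. card (bounding_edges F f) = 2 \<and> f = open_disc C \<inter> open_disc D)"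

text \<open>The edges of the geometric graph on the centres, as straight-line segments.\<close>

definition red_edges :: "circle set \<Rightarrow> (real^2) set set" where
  "red_edges F =
     {closed_segment (center C) (center D) | C D. C \<in> F \<and> D \<in> F \<and> creates_lens F C D}"

definition blue_edges :: "circle set \<Rightarrow> (real^2) set set" where
  "blue_edges F =
     {closed_segment (center C) (center D) | C D. C \<in> F \<and> D \<in> F \<and> touch C D}"

definition graph_edges :: "circle set \<Rightarrow> (real^2) set set" where
  "graph_edges F = red_edges F \<union> blue_edges F"

text \<open>A convex quadrilateral is a convex polygon with exactly four vertices (extreme points, so
  no three of them are collinear); two of its edges are opposite iff they are disjoint.\<close>

definition convex_quadrilateral :: "(real^2) set \<Rightarrow> bool" where
  "convex_quadrilateral Q \<longleftrightarrow> polytope Q \<and> card {v. v extreme_point_of Q} = 4"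

definition opposite_edges :: "(real^2) set \<Rightarrow> (real^2) set \<Rightarrow> (real^2) set \<Rightarrow> bool" where
  "opposite_edges Q s t \<longleftrightarrow> s edge_of Q \<and> t edge_of Q \<and> s \<inter> t = {}"

definition avoiding :: "(real^2) set \<Rightarrow> (real^2) set \<Rightarrow> bool" where
  "avoiding s t \<longleftrightarrow> (\<exists>Q. convex_quadrilateral Q \<and> opposite_edges Q s t)"

definition touching_quadruple ::
  "circle set \<Rightarrow> circle \<Rightarrow> circle \<Rightarrow> circle \<Rightarrow> circle \<Rightarrow> bool" where
  "touching_quadruple F C1 C2 C3 C4 \<longleftrightarrow>
     {C1, C2, C3, C4} \<subseteq> F \<and> distinct [C1, C2, C3, C4] \<and>
     (\<exists>p. p \<in> circ C1 \<and> p \<in> circ C2 \<and> p \<in> circ C3 \<and> p \<in> circ C4 \<and>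
          touch_at C1 C3 p \<and> touch_at C2 C4 p)"

end

theory Submission
  imports Defs
begin

text \<open>If \<open>C\<close> and \<open>D\<close> touch or create a lens, then no third circle of the family meets the lens or its
  two open sides; for the sides this is the condition that the lens has only two edges.
  Let \<open>AB\<close> and \<open>CD\<close> be avoiding edges whose diagonals \<open>ac\<close>, \<open>bd\<close> cross at \<open>z\<close>. As \<open>A\<close>, \<open>C\<close>
  intersect and \<open>B\<close>, \<open>D\<close> intersect, \<open>z\<close> lies in a disc of each pair, say in \<open>A\<close> and \<open>D\<close>. Extend
  \<open>az\<close> to the point \<open>m\<close> of \<open>A\<close> and \<open>dz\<close> to the point \<open>k\<close> of \<open>D\<close>. Then \<open>m\<close> lies in the disc of
  \<open>C\<close>, so it is not inside \<open>D\<close>, and likewise \<open>k\<close> is not inside \<open>A\<close>. Hence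
  \<open>|am| + |dk| \<le> |ak| + |dm|\<close>, which for segments crossing at \<open>z\<close> is possible only if
  \<open>m = k = z\<close>. Then all four circles pass through \<open>z\<close>, and \<open>A\<close>, \<open>C\<close> as well as \<open>B\<close>, \<open>D\<close> touch there.
  If \<open>z\<close> lies only in the discs of \<open>A\<close> and \<open>B\<close>, the same argument, with the points where \<open>zc\<close> and
  \<open>zd\<close> enter \<open>C\<close> and \<open>D\<close>, gives a contradiction.\<close>

section \<open>Points on segments\<close>

lemma closed_segment_scaled:
  fixes a v :: "'a::real_vector"
  assumes "0 \<le> u" "u \<le> w"
  shows "a + u *\<^sub>R v \<in> closed_segment a (a + w *\<^sub>R v)"
proof (cases "w = 0")
  case True
  then show ?thesis using assms by simp
next
  case False
  then have "w > 0" using assms by simp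
  then have "a + u *\<^sub>R v = (1 - u / w) *\<^sub>R a + (u / w) *\<^sub>R (a + w *\<^sub>R v)"
    by (simp add: algebra_simps)
  moreover have "0 \<le> u / w" "u / w \<le> 1" using assms \<open>w > 0\<close> by auto
  ultimately show ?thesis unfolding in_segment by blast
qed

lemma closed_segment_scaledE:
  fixes a c :: "'a::real_vector"
  assumes "z \<in> closed_segment a c"
  obtains u where "0 \<le> u" "u \<le> 1" "z = a + u *\<^sub>R (c - a)"
proof -
  obtain u where "0 \<le> u" "u \<le> 1" "z = (1 - u) *\<^sub>R a + u *\<^sub>R c"
    using assms unfolding in_segment by blast
  then show ?thesis by (intro that[of u]) (simp_all add: algebra_simps)
qed

text \<open>The witness is the point at distance \<open>r\<close> from \<open>a\<close> on the ray
  towards \<open>c\<close>. It may lie beyond \<open>c\<close>, so its distance to \<open>c\<close>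
  is an absolute value, and \<open>up\<close> and \<open>lo\<close> bound the two signs.\<close>

lemma segment_exit_point:
  fixes a c :: "'a::real_normed_vector"
  assumes z: "z \<in> closed_segment a c" and "a \<noteq> c" and zr: "dist a z \<le> r"
    and up: "dist a c \<le> r + s" and lo: "r \<le> dist a c + s"
  obtains m where "dist a m = r" "dist c m \<le> s" "z \<in> closed_segment a m"
proof -
  obtain u where u: "0 \<le> u" "u \<le> 1" "z = a + u *\<^sub>R (c - a)"
    using z by (rule closed_segment_scaledE)
  define l where "l = norm (c - a)"
  have l: "l > 0" "dist a c = l" using \<open>a \<noteq> c\<close> by (simp_all add: l_def dist_norm norm_minus_commute)
  have r: "r \<ge> 0" using zr zero_le_dist[of a z] by linarith
  define m where "m = a + (r / l) *\<^sub>R (c - a)"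
  have "u * l \<le> r" using zr u by (simp add: dist_norm l_def)
  then have "u \<le> r / l" using l by (simp add: field_simps)
  then have "z \<in> closed_segment a m"
    unfolding m_def u(3) using u(1) by (rule closed_segment_scaled[rotated])
  moreover have "dist a m = r" using r l by (simp add: m_def dist_norm flip: l_def)
  moreover have "dist c m \<le> s"
  proof -
    have "c - m = (1 - r / l) *\<^sub>R (c - a)" by (simp add: m_def algebra_simps)
    then have "dist c m = \<bar>1 - r / l\<bar> * l" by (simp add: dist_norm l_def)
    also have "\<dots> = \<bar>(1 - r / l) * l\<bar>" using l by (simp add: abs_mult)
    also have "\<dots> = \<bar>l - r\<bar>" using l by (simp add: left_diff_distrib)
    finally show ?thesis using up lo l by auto
  qed
  ultimately show ?thesis using that by blast
qed

text \<open>Here the witness is measured back from \<open>c\<close>. As \<open>z\<close> lies before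
  it on the segment, it never passes behind \<open>a\<close>, and its distance to \<open>a\<close>
  is the distance of \<open>a\<close> and \<open>c\<close> minus \<open>s\<close>.\<close>

lemma segment_entry_point:
  fixes a c :: "'a::real_normed_vector"
  assumes z: "z \<in> closed_segment a c" and "a \<noteq> c" and zs: "s \<le> dist c z" and "0 \<le> s"
    and up: "dist a c \<le> r + s"
  obtains m where "dist c m = s" "dist a m \<le> r" "z \<in> closed_segment a m"
proof -
  obtain u where u: "0 \<le> u" "u \<le> 1" "z = a + u *\<^sub>R (c - a)"
    using z by (rule closed_segment_scaledE)
  define l where "l = norm (c - a)"
  have l: "l > 0" "dist a c = l" using \<open>a \<noteq> c\<close> by (simp_all add: l_def dist_norm norm_minus_commute)
  define m where "m = a + (1 - s / l) *\<^sub>R (c - a)"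
  have "c - z = (1 - u) *\<^sub>R (c - a)" by (simp add: u algebra_simps)
  then have "s \<le> (1 - u) * l" using zs u by (simp add: dist_norm l_def)
  then have ul: "u \<le> 1 - s / l" using l by (simp add: field_simps)
  then have "z \<in> closed_segment a m"
    unfolding m_def u(3) using u(1) by (rule closed_segment_scaled[rotated])
  moreover have "dist c m = s"
  proof -
    have "c - m = (s / l) *\<^sub>R (c - a)" by (simp add: m_def algebra_simps)
    then show ?thesis using \<open>0 \<le> s\<close> l by (simp add: dist_norm flip: l_def)
  qed
  moreover have "dist a m \<le> r"
  proof -
    have "dist a m = \<bar>1 - s / l\<bar> * l" by (simp add: m_def dist_norm l_def)
    also have "\<dots> = (1 - s / l) * l" using ul u(1) by simp
    also have "\<dots> = l - s" using l by (simp add: left_diff_distrib)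
    finally show ?thesis using up l by simp
  qed
  ultimately show ?thesis using that by blast
qed

lemma in_closed_segment_dist:
  fixes a b x :: "'a::euclidean_space"
  shows "x \<in> closed_segment a b \<longleftrightarrow> dist a b = dist a x + dist x b"
  using between[of a b x] by (simp add: between_mem_segment)

lemma collinear_segment_ends:
  fixes a b c z :: "'a::euclidean_space"
  assumes "collinear {a, b, z}" "z \<in> closed_segment a c" "z \<noteq> a"
  shows "collinear {a, b, c}"
proof -
  have "collinear {a, z, c}"
    using assms(2) by (metis between_imp_collinear between_mem_segment)
  moreover have "collinear {b, a, z}" using assms(1) by (simp add: insert_commute)
  ultimately have "collinear {b, a, c}" using assms(3) by (metis collinear_3_trans)
  then show ?thesis by (simp add: insert_commute)
qed

text \<open>The triangle inequality in the triangles \<open>a z k\<close> and \<open>b z m\<close> gives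
  \<open>dist a k + dist b m \<le> dist a m + dist b k\<close>, so everything must be degenerate.\<close>

lemma crossing_segments_eq:
  fixes a b m k z :: "'a::euclidean_space"
  assumes zm: "z \<in> closed_segment a m" and zk: "z \<in> closed_segment b k"
    and le: "dist a m \<le> dist a k" "dist b k \<le> dist b m"
    and ncol: "\<not> collinear {a, b, z}"
  shows "m = z" and "k = z"
proof -
  have "dist a m = dist a z + dist z m" "dist b k = dist b z + dist z k"
    using zm zk by (simp_all add: in_closed_segment_dist)
  moreover have "dist a k \<le> dist a z + dist z k" "dist b m \<le> dist b z + dist z m"
    by (rule dist_triangle)+
  \<comment> \<open>Both triangle inequalities are equalities, so \<open>z\<close> lies also between
    \<open>a\<close> and \<open>k\<close> and between \<open>b\<close> and \<open>m\<close>.\<close>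
  ultimately have eqs: "dist a k = dist a z + dist z k" "dist b m = dist b z + dist z m"
    using le by linarith+
  \<comment> \<open>For \<open>x\<close> different from \<open>z\<close>, the points
    \<open>a\<close> and \<open>b\<close> would both lie on the line through \<open>z\<close> and
    \<open>x\<close>.\<close>
  have col: "x = z" if "z \<in> closed_segment a x" "z \<in> closed_segment b x" for x
  proof (rule ccontr)
    assume "x \<noteq> z"
    have "collinear {a, z, x}" "collinear {b, z, x}"
      using that by (metis between_imp_collinear between_mem_segment)+
    then have "collinear {a, z, x}" "collinear {z, x, b}" by (simp_all add: insert_commute)
    then have "collinear {a, z, b}" using \<open>x \<noteq> z\<close> by (intro collinear_3_trans[of a z x b]) auto
    then show False using ncol by (simp add: insert_commute)
  qed
  show "m = z" using col[of m] zm eqs by (simp add: in_closed_segment_dist)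
  show "k = z" using col[of k] zk eqs by (simp add: in_closed_segment_dist)
qed

section \<open>Four circles with crossing diagonals\<close>

text \<open>The two regions together form the closed lens without the common points of its circles.
  \<open>E\<close> may thus pass through a corner, as happens in the exceptional
  configuration.\<close>

definition uncut :: "circle \<Rightarrow> circle \<Rightarrow> circle \<Rightarrow> bool" where
  "uncut C D E \<longleftrightarrow> circ E \<inter> closed_disc C \<inter> open_disc D = {} \<and>
                   circ E \<inter> open_disc C \<inter> closed_disc D = {}"

text \<open>The strict lower bound is non-containment of the discs in metric form; it forces
  distinct centres and leaves only external tangency.\<close>

definition meet_properly :: "circle \<Rightarrow> circle \<Rightarrow> bool" where
  "meet_properly C D \<longleftrightarrow> dist (center C) (center D) \<le> radius C + radius D \<and>
     \<bar>radius C - radius D\<bar> < dist (center C) (center D)"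

lemma meet_properly_commute: "meet_properly C D \<longleftrightarrow> meet_properly D C"
  by (auto simp: meet_properly_def dist_commute)

lemmas disc_defs = circ_def open_disc_def closed_disc_def

text \<open>\<open>A\<close> and \<open>D\<close> belong to different edges and different diagonals.
  Since \<open>A\<close> does not cut \<open>C\<close>, \<open>D\<close>, the exit point
  \<open>m\<close> is not inside \<open>D\<close>; since \<open>D\<close> does not cut
  \<open>A\<close>, \<open>B\<close>, the exit point \<open>k\<close> is not inside
  \<open>A\<close>.\<close>

lemma diagonals_meet_in_nonadjacent_discs:
  assumes meet: "meet_properly A C" "meet_properly B D"
    and unc: "uncut A B D" "uncut C D A"
    and z: "z \<in> closed_segment (center A) (center C)" "z \<in> closed_segment (center B) (center D)"
    and zin: "z \<in> closed_disc A" "z \<in> closed_disc D"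
    and ncol: "\<not> collinear {center A, center D, z}"
  shows "z \<in> circ A \<inter> circ B \<inter> circ C \<inter> circ D"
proof -
  obtain m where m: "dist (center A) m = radius A" "dist (center C) m \<le> radius C"
      "z \<in> closed_segment (center A) m"
    by (rule segment_exit_point[OF z(1), of "radius A" "radius C"])
      (use meet zin in \<open>auto simp: meet_properly_def disc_defs\<close>)
  obtain k where k: "dist (center D) k = radius D" "dist (center B) k \<le> radius B"
      "z \<in> closed_segment (center D) k"
    by (rule segment_exit_point[of z "center D" "center B" "radius D" "radius B"])
      (use meet zin z in \<open>auto simp: meet_properly_def disc_defs dist_commute closed_segment_commute\<close>)
  have "m \<in> circ A \<inter> closed_disc C" "k \<in> circ D \<inter> closed_disc B"
    using m k by (auto simp: disc_defs)
  then have "m \<notin> open_disc D" "k \<notin> open_disc A" using unc by (auto simp: uncut_def)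
  then have "dist (center A) m \<le> dist (center A) k" "dist (center D) k \<le> dist (center D) m"
    using m k by (auto simp: disc_defs)
  then have "m = z" "k = z" using crossing_segments_eq[OF m(3) k(3)] ncol by blast+
  then have "z \<in> circ A" "z \<in> circ D" "z \<in> closed_disc B" "z \<in> closed_disc C"
    using m k by (auto simp: disc_defs)
  \<comment> \<open>Now \<open>z\<close> is a point of \<open>A\<close> in the closed disc of
    \<open>D\<close>, so it cannot be inside \<open>C\<close>; the same argument with
    \<open>D\<close> and \<open>A\<close> keeps it out of \<open>B\<close>.\<close>
  moreover from this have "z \<notin> open_disc C" "z \<notin> open_disc B"
    using unc zin by (auto simp: uncut_def)
  ultimately show ?thesis by (auto simp: disc_defs)
qed

text \<open>The entry points into \<open>C\<close> and \<open>D\<close> replace the exit points.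
  They lie in the closed discs of \<open>A\<close> and \<open>B\<close>, so \<open>uncut\<close>
  keeps them out of the open discs of \<open>B\<close> and \<open>A\<close>. They collapse to
  \<open>z\<close>, which is impossible as \<open>z\<close> lies off \<open>C\<close>.\<close>

lemma diagonals_meet_in_adjacent_discs:
  assumes meet: "meet_properly A C" "meet_properly B D"
    and pos: "radius C > 0" "radius D > 0"
    and unc: "uncut A B C" "uncut A B D"
    and z: "z \<in> closed_segment (center A) (center C)" "z \<in> closed_segment (center B) (center D)"
    and zout: "z \<notin> closed_disc C" "z \<notin> closed_disc D"
    and ncol: "\<not> collinear {center A, center B, z}"
  shows False
proof -
  obtain m where m: "dist (center C) m = radius C" "dist (center A) m \<le> radius A"
      "z \<in> closed_segment (center A) m"
    by (rule segment_entry_point[OF z(1), of "radius C" "radius A"])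
      (use meet zout pos in \<open>auto simp: meet_properly_def disc_defs\<close>)
  obtain k where k: "dist (center D) k = radius D" "dist (center B) k \<le> radius B"
      "z \<in> closed_segment (center B) k"
    by (rule segment_entry_point[OF z(2), of "radius D" "radius B"])
      (use meet zout pos in \<open>auto simp: meet_properly_def disc_defs\<close>)
  have "m \<in> circ C \<inter> closed_disc A" "k \<in> circ D \<inter> closed_disc B"
    using m k by (auto simp: disc_defs)
  then have "m \<notin> open_disc B" "k \<notin> open_disc A" using unc by (auto simp: uncut_def)
  then have "dist (center A) m \<le> dist (center A) k" "dist (center B) k \<le> dist (center B) m"
    using m k by (auto simp: disc_defs)
  then have "m = z" using crossing_segments_eq[OF m(3) k(3)] ncol by blast
  then show False using m zout by (auto simp: disc_defs)
qed

lemma segment_subset_closed_discs: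
  assumes "meet_properly A C" "z \<in> closed_segment (center A) (center C)"
  shows "z \<in> closed_disc A \<or> z \<in> closed_disc C"
  using assms by (auto simp: meet_properly_def disc_defs in_closed_segment_dist dist_commute)

lemma diagonals_meet_on_circles:
  assumes meet: "meet_properly A C" "meet_properly B D"
    and pos: "radius A > 0" "radius B > 0" "radius C > 0" "radius D > 0"
    and unc: "uncut A B C" "uncut A B D" "uncut C D A" "uncut C D B"
    and z: "z \<in> closed_segment (center A) (center C)" "z \<in> closed_segment (center B) (center D)"
    and ncol: "\<not> collinear {center A, center B, z}" "\<not> collinear {center A, center D, z}"
      "\<not> collinear {center C, center B, z}" "\<not> collinear {center C, center D, z}"
  shows "z \<in> circ A \<inter> circ B \<inter> circ C \<inter> circ D"
proof -
  have meet': "meet_properly C A" "meet_properly D B"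
    using meet by (simp_all add: meet_properly_commute)
  have z': "z \<in> closed_segment (center C) (center A)" "z \<in> closed_segment (center D) (center B)"
    using z by (simp_all add: closed_segment_commute)
  \<comment> \<open>Each diagonal offers a disc containing \<open>z\<close>. If these discs cannot
    be chosen from different edges, then \<open>z\<close> misses both discs of one edge.\<close>
  consider "z \<in> closed_disc A" "z \<in> closed_disc D" | "z \<in> closed_disc C" "z \<in> closed_disc B"
    | "z \<notin> closed_disc C" "z \<notin> closed_disc D" | "z \<notin> closed_disc A" "z \<notin> closed_disc B"
    using segment_subset_closed_discs[OF meet(1) z(1)] segment_subset_closed_discs[OF meet(2) z(2)]
    by blast
  then show ?thesis
  proof cases
    case 1
    then show ?thesis
      using diagonals_meet_in_nonadjacent_discs[OF meet unc(2,3) z] ncol by blast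
  next
    case 2
    then show ?thesis
      using diagonals_meet_in_nonadjacent_discs[OF meet' unc(4,1) z'] ncol by blast
  next
    case 3
    then show ?thesis
      using diagonals_meet_in_adjacent_discs[OF meet pos(3,4) unc(1,2) z] ncol by blast
  next
    case 4
    then show ?thesis
      using diagonals_meet_in_adjacent_discs[OF meet' pos(1,2) unc(3,4) z'] ncol by blast
  qed
qed

section \<open>Touching circles\<close>

text \<open>A unique common point is fixed by the reflection in the line of centres, hence lies on
  that line. Outside the segment of centres it would be an internal tangency, which
  \<open>meet_properly\<close> rules out.\<close>

lemma touch_dist:
  assumes "touch C D" "meet_properly C D"
  shows "dist (center C) (center D) = radius C + radius D"
proof -
  obtain p where p: "circ C \<inter> circ D = {p}" using assms(1) by (auto simp: touch_def touch_at_def)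
  define n where "n = center D - center C"
  define v where "v = p - center C"
  have n: "n \<noteq> 0" using assms(2) by (auto simp: meet_properly_def n_def)
  have v: "norm v = radius C" "norm (v - n) = radius D"
    using p by (auto simp: circ_def v_def n_def dist_norm norm_minus_commute)
  \<comment> \<open>The vector \<open>\<tau> *\<^sub>R n\<close> is the orthogonal projection of
    \<open>v\<close> to the line of centres.\<close>
  define \<tau> where "\<tau> = (v \<bullet> n) / (n \<bullet> n)"
  have vn: "\<tau> * (n \<bullet> n) = v \<bullet> n" using n by (simp add: \<tau>_def)
  txt \<open>The mirror image of \<open>p\<close> in the line of centres is again a common point.\<close>
  define w where "w = (2 * \<tau>) *\<^sub>R n - v"
  have wn: "w \<bullet> n = v \<bullet> n" using vn by (simp add: w_def inner_diff_left)
  have "w \<bullet> w = v \<bullet> v + 4 * \<tau> * (\<tau> * (n \<bullet> n) - v \<bullet> n)"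
    by (simp add: w_def inner_diff_left inner_diff_right inner_commute algebra_simps)
  then have ww: "w \<bullet> w = v \<bullet> v" using vn by simp
  have "(w - n) \<bullet> (w - n) = (v - n) \<bullet> (v - n)"
    using ww wn by (simp add: inner_diff_left inner_diff_right inner_commute)
  then have "norm w = radius C" "norm (w - n) = radius D"
    using ww v by (simp_all add: norm_eq_sqrt_inner)
  then have "center C + w \<in> circ C \<inter> circ D"
    by (auto simp: circ_def dist_norm n_def norm_minus_commute algebra_simps)
  then have "w = v" using p by (auto simp: v_def)
  then have "2 *\<^sub>R v = 2 *\<^sub>R (\<tau> *\<^sub>R n)" by (simp add: w_def algebra_simps scaleR_2)
  then have v\<tau>: "v = \<tau> *\<^sub>R n" by (metis scaleR_left_imp_eq zero_neq_numeral)
  then have "v - n = (\<tau> - 1) *\<^sub>R n" by (simp add: algebra_simps)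
  then have C: "radius C = \<bar>\<tau>\<bar> * norm n" and D: "radius D = \<bar>\<tau> - 1\<bar> * norm n"
    using v v\<tau> by simp_all
  have l: "dist (center C) (center D) = norm n" by (simp add: n_def dist_norm norm_minus_commute)
  have "\<tau> \<ge> 0"
  proof (rule ccontr)
    assume "\<not> \<tau> \<ge> 0"
    then have "radius D - radius C = norm n" using C D by (simp add: algebra_simps)
    then show False using assms(2) l by (auto simp: meet_properly_def)
  qed
  moreover have "\<tau> \<le> 1"
  proof (rule ccontr)
    assume "\<not> \<tau> \<le> 1"
    then have "radius C - radius D = norm n" using C D by (simp add: algebra_simps)
    then show False using assms(2) l by (auto simp: meet_properly_def)
  qed
  ultimately show ?thesis using C D l by (simp add: algebra_simps)
qed

text \<open>For externally tangent circles both regions in \<open>uncut\<close> are empty, so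
  nothing is left for \<open>E\<close> to cut.\<close>

lemma uncut_if_dist:
  assumes "dist (center C) (center D) = radius C + radius D"
  shows "uncut C D E"
proof -
  have "radius C + radius D \<le> dist (center C) x + dist (center D) x" for x
    using dist_triangle2[of "center C" "center D" x] assms by simp
  then have "\<not> (dist (center C) x \<le> radius C \<and> dist (center D) x < radius D)"
    "\<not> (dist (center C) x < radius C \<and> dist (center D) x \<le> radius D)" for x
    by (smt (verit))+
  then have "closed_disc C \<inter> open_disc D = {}" "open_disc C \<inter> closed_disc D = {}"
    by (auto simp: disc_defs)
  then show ?thesis by (auto simp: uncut_def)
qed

text \<open>A common point between the centres makes their distance the sum of the radii. Every
  common point then lies on that segment, where its distance to one centre determines it.\<close>

lemma touch_atI:
  assumes "C \<noteq> D" and p: "p \<in> circ C" "p \<in> circ D"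
    and seg: "p \<in> closed_segment (center C) (center D)"
  shows "touch_at C D p"
proof -
  have CD: "dist (center C) (center D) = radius C + radius D"
    using p seg by (simp add: in_closed_segment_dist circ_def dist_commute)
  have "q = p" if "q \<in> circ C \<inter> circ D" for q
  proof -
    have q: "q \<in> closed_segment (center C) (center D)"
      using that CD by (simp add: in_closed_segment_dist circ_def dist_commute)
    obtain u where u: "0 \<le> u" "q = center C + u *\<^sub>R (center D - center C)"
      using q by (rule closed_segment_scaledE)
    obtain w where w: "0 \<le> w" "p = center C + w *\<^sub>R (center D - center C)"
      using seg by (rule closed_segment_scaledE)
    have "dist (center C) q = dist (center C) p" using that p by (simp add: circ_def)
    then show "q = p" using u w by (auto simp: dist_norm)
  qed
  then have "circ C \<inter> circ D = {p}" using p by blast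
  then show ?thesis using \<open>C \<noteq> D\<close> by (simp add: touch_at_def)
qed

section \<open>Circles do not cut lenses\<close>

text \<open>The determinant of \<open>p - m\<close> and \<open>x - m\<close>: it vanishes on the
  line through \<open>m\<close> and \<open>p\<close>, and its sign tells the two half-planes
  apart.\<close>

definition side :: "real^2 \<Rightarrow> real^2 \<Rightarrow> real^2 \<Rightarrow> real" where
  "side m p x = (x$2 - m$2) * (p$1 - m$1) - (x$1 - m$1) * (p$2 - m$2)"

lemma sphere_real2_iff:
  fixes c x :: "real^2"
  assumes "r \<ge> 0"
  shows "x \<in> sphere c r \<longleftrightarrow> (x$1 - c$1)\<^sup>2 + (x$2 - c$2)\<^sup>2 = r\<^sup>2"
proof -
  have "dist c x = sqrt ((x$1 - c$1)\<^sup>2 + (x$2 - c$2)\<^sup>2)"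
    by (simp add: dist_norm norm_vec_def L2_set_def sum_2 power2_commute)
  then show ?thesis using assms
    by (auto simp: real_sqrt_unique)
qed

text \<open>A line meets a circle at most twice: at \<open>m + t (p - m)\<close> the equation of the
  circle becomes \<open>t (t - 1) = 0\<close>, up to a nonzero factor.\<close>

lemma side_eq_0_on_sphere:
  assumes "x \<in> sphere c r" "m \<in> sphere c r" "p \<in> sphere c r" "m \<noteq> p" "side m p x = 0"
  shows "x = m \<or> x = p"
proof -
  have r: "r \<ge> 0" using assms(2) zero_le_dist[of c m] by simp
  define X Y P Q M N where "X = x$1 - m$1" and "Y = x$2 - m$2" and "P = p$1 - m$1"
    and "Q = p$2 - m$2" and "M = m$1 - c$1" and "N = m$2 - c$2"
  note defs = X_def Y_def P_def Q_def M_def N_def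
  have sph: "(x$1 - c$1)\<^sup>2 + (x$2 - c$2)\<^sup>2 = r\<^sup>2" "(m$1 - c$1)\<^sup>2 + (m$2 - c$2)\<^sup>2 = r\<^sup>2"
    "(p$1 - c$1)\<^sup>2 + (p$2 - c$2)\<^sup>2 = r\<^sup>2"
    using assms(1-3) unfolding sphere_real2_iff[OF r] .
  have e1: "X\<^sup>2 + Y\<^sup>2 + 2 * (X * M + Y * N) = 0"
    using sph(1,2) unfolding defs by (simp add: power2_eq_square algebra_simps)
  have e2: "P\<^sup>2 + Q\<^sup>2 + 2 * (P * M + Q * N) = 0"
    using sph(3,2) unfolding defs by (simp add: power2_eq_square algebra_simps)
  have e3: "Y * P = X * Q" using assms(5) unfolding defs side_def by simp
  have PQ: "P\<^sup>2 + Q\<^sup>2 \<noteq> 0"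
    using assms(4) unfolding defs by (auto simp: sum_power2_eq_zero_iff vec_eq_iff forall_2)
  define t where "t = (X * P + Y * Q) / (P\<^sup>2 + Q\<^sup>2)"
  have tX: "X = t * P" and tY: "Y = t * Q"
    using PQ e3 by (simp_all add: t_def field_simps power2_eq_square)
  have "t * (t - 1) * (P\<^sup>2 + Q\<^sup>2) = 0"
    using e1 e2 unfolding tX tY by algebra
  then have "t = 0 \<or> t = 1" using PQ by auto
  then show ?thesis
    using tX tY unfolding defs by (auto simp: vec_eq_iff forall_2)
qed

text \<open>The circle crosses its chord transversally at \<open>m\<close>: along a rotation of
  \<open>m\<close> about the centre, \<open>side\<close> vanishes at angle 0 with negative
  derivative, so it changes sign there.\<close>

lemma circle_points_on_both_sides:
  assumes m: "m \<in> sphere c r" and p: "p \<in> sphere c r" and "m \<noteq> p" and U: "open U" "m \<in> U"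
  obtains u v where "u \<in> sphere c r \<inter> U" "side m p u < 0" "v \<in> sphere c r \<inter> U" "side m p v > 0"
proof -
  have r: "r \<ge> 0" using m zero_le_dist[of c m] by simp
  define M N where "M = m$1 - c$1" and "N = m$2 - c$2"
  define P Q where "P = p$1 - m$1" and "Q = p$2 - m$2"
  define x :: "real \<Rightarrow> real^2" where
    "x t = c + vector [cos t * M - sin t * N, cos t * N + sin t * M]" for t
  have MN: "M\<^sup>2 + N\<^sup>2 = r\<^sup>2" using m unfolding sphere_real2_iff[OF r] M_def N_def .
  have "(P + M)\<^sup>2 + (Q + N)\<^sup>2 = r\<^sup>2"
    using p unfolding sphere_real2_iff[OF r] by (simp add: M_def N_def P_def Q_def)
  then have PM: "2 * (P * M + Q * N) = - (P\<^sup>2 + Q\<^sup>2)"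
    using MN by (simp add: power2_eq_square algebra_simps)
  have "P\<^sup>2 + Q\<^sup>2 > 0"
    using \<open>m \<noteq> p\<close> by (auto simp: P_def Q_def sum_power2_gt_zero_iff vec_eq_iff forall_2)
  \<comment> \<open>This is the inner product of \<open>m - c\<close> and \<open>p - m\<close>; both
    points lie on the circle, so it is minus half the squared length of the chord.\<close>
  then have neg: "M * P + N * Q < 0" using PM by (simp add: algebra_simps)
  have xs: "x t \<in> sphere c r" for t
  proof -
    have "(cos t * M - sin t * N)\<^sup>2 + (cos t * N + sin t * M)\<^sup>2 = ((cos t)\<^sup>2 + (sin t)\<^sup>2) * (M\<^sup>2 + N\<^sup>2)"
      by algebra
    then show ?thesis unfolding sphere_real2_iff[OF r] using MN by (simp add: x_def)
  qed
  have x0: "x 0 = m" by (simp add: x_def M_def N_def vec_eq_iff forall_2)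
  have "isCont x 0"
    unfolding x_def isCont_def
    by (rule vec_tendstoI) (auto intro!: tendsto_eq_intros simp: exhaust_2 vector_def)
  then have "(x \<longlongrightarrow> m) (at 0)" using x0 by (simp add: isCont_def)
  then have "eventually (\<lambda>t. x t \<in> U) (at 0)" using U topological_tendstoD by blast
  then obtain e where e: "e > 0" "\<And>t. t \<noteq> 0 \<Longrightarrow> \<bar>t\<bar> < e \<Longrightarrow> x t \<in> U"
    by (auto simp: eventually_at dist_norm)
  define s where "s t = side m p (x t)" for t
  have s: "s t = (cos t * N + sin t * M - N) * P - (cos t * M - sin t * N - M) * Q" for t
    by (simp add: s_def side_def x_def P_def Q_def M_def N_def algebra_simps)
  have der: "(s has_real_derivative M * P + N * Q) (at 0)"
    unfolding s by (auto intro!: derivative_eq_intros)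
  have s0: "s 0 = 0" by (simp add: s)
  obtain d1 where d1: "d1 > 0" "\<And>h. 0 < h \<Longrightarrow> h < d1 \<Longrightarrow> s h < 0"
    using DERIV_neg_dec_right[OF der neg] s0 by auto
  obtain d2 where d2: "d2 > 0" "\<And>h. 0 < h \<Longrightarrow> h < d2 \<Longrightarrow> s (- h) > 0"
    using DERIV_neg_dec_left[OF der neg] s0 by auto
  define h where "h = min e (min d1 d2) / 2"
  have h: "0 < h" "h < e" "h < d1" "h < d2" using e d1 d2 by (auto simp: h_def)
  show ?thesis
    by (rule that[of "x h" "x (- h)"])
      (use xs h e(2)[of h] e(2)[of "- h"] d1(2)[of h] d2(2)[of h] in \<open>auto simp: s_def\<close>)
qed

text \<open>All common points lie on one line orthogonal to the line of centres, and a line meets a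
  circle at most twice.\<close>

lemma finite_circ_Int_circ:
  assumes "center C \<noteq> center D"
  shows "finite (circ C \<inter> circ D)"
proof (cases "\<exists>m p. m \<in> circ C \<inter> circ D \<and> p \<in> circ C \<inter> circ D \<and> m \<noteq> p")
  case True
  then obtain m p where mp: "m \<in> circ C \<inter> circ D" "p \<in> circ C \<inter> circ D" "m \<noteq> p" by blast
  have r: "radius C \<ge> 0" "radius D \<ge> 0" using mp(1) zero_le_dist[of "center C" m] zero_le_dist[of "center D" m] by (auto simp: circ_def)
  define U V where "U = center D $ 1 - center C $ 1" and "V = center D $ 2 - center C $ 2"
  have UV: "U\<^sup>2 + V\<^sup>2 \<noteq> 0"
    using assms by (auto simp: U_def V_def sum_power2_eq_zero_iff vec_eq_iff forall_2)
  txt \<open>Common points differ by vectors orthogonal to the line of centres.\<close>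
  have orth: "(x$1 - m$1) * U + (x$2 - m$2) * V = 0" if "x \<in> circ C \<inter> circ D" for x
    using that mp(1)
    unfolding circ_def Int_iff sphere_real2_iff[OF r(1)] sphere_real2_iff[OF r(2)] U_def V_def
    by algebra
  have "x \<in> {m, p}" if x: "x \<in> circ C \<inter> circ D" for x
  proof -
    have "(U\<^sup>2 + V\<^sup>2) * side m p x = 0"
      using orth[OF x] orth[OF mp(2)] unfolding side_def by algebra
    then have "side m p x = 0" using UV mult_eq_0_iff by blast
    then show ?thesis
      using side_eq_0_on_sphere[of x "center C" "radius C" m p] x mp by (auto simp: circ_def)
  qed
  then have "circ C \<inter> circ D \<subseteq> {m, p}" by blast
  then show ?thesis by (rule finite_subset) simp
next
  case False
  then have "circ C \<inter> circ D \<subseteq> {q}" if "q \<in> circ C \<inter> circ D" for q using that by blast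
  then show ?thesis by (metis finite.emptyI finite_insert finite_subset equals0I)
qed

text \<open>An edge of \<open>C\<close> that contains a point inside \<open>D\<close> cannot leave
  \<open>D\<close> without passing a common point of the circles, which is a vertex. So the whole
  edge borders the lens.\<close>

lemma lens_edge:
  assumes "C \<in> F" "D \<in> F" "C \<noteq> D" and u: "u \<in> circ C" "u \<in> open_disc D" "u \<notin> arr_vertices F"
    and pos: "radius C > 0"
  defines "e \<equiv> connected_component_set (circ C - arr_vertices F) u"
  shows "e \<in> bounding_edges F (open_disc C \<inter> open_disc D)" "u \<in> e" "connected e"
    "e \<subseteq> circ C - arr_vertices F"
proof -
  have u': "u \<in> circ C - arr_vertices F" using u by simp
  show ue: "u \<in> e" using u' by (simp add: e_def)
  show con: "connected e" by (simp add: e_def)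
  show sub: "e \<subseteq> circ C - arr_vertices F" unfolding e_def by (rule connected_component_subset)
  have edge: "e \<in> arr_edges F"
    using u' \<open>C \<in> F\<close> unfolding e_def arr_edges_def components_def by blast
  have "circ C \<inter> circ D \<subseteq> arr_vertices F" using assms(1-3) by (auto simp: arr_vertices_def)
  then have "e \<inter> circ D = {}" using sub by blast
  then have "e \<inter> frontier (open_disc D) = {}"
    using closure_minimal[of "open_disc D" "closed_disc D"]
    by (force simp: disc_defs frontier_def interior_open)
  then have eD: "e \<subseteq> open_disc D"
    using connected_Int_frontier[OF con, of "open_disc D"] ue u by blast
  have "x \<in> frontier (open_disc C \<inter> open_disc D)" if "x \<in> e" for x
  proof -
    have x: "x \<in> circ C" "x \<in> open_disc D" using that sub eD by auto
    \<comment> \<open>Points inside \<open>C\<close> accumulate at \<open>x\<close>, and those near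
      \<open>x\<close> are also inside \<open>D\<close>.\<close>
    have "x \<in> closure (open_disc C)" using x pos by (auto simp: disc_defs)
    then have "x \<in> closure (open_disc D \<inter> open_disc C)"
      using x open_Int_closure_subset[of "open_disc D" "open_disc C"] by (auto simp: open_disc_def)
    moreover have "open (open_disc C \<inter> open_disc D)" by (simp add: open_disc_def open_Int)
    moreover have "x \<notin> open_disc C" using x by (auto simp: disc_defs)
    ultimately show ?thesis by (simp add: frontier_def interior_open Int_commute del: interior_Int)
  qed
  then show "e \<in> bounding_edges F (open_disc C \<inter> open_disc D)"
    using edge by (auto simp: bounding_edges_def)
qed

text \<open>A vertex \<open>m\<close> inside a side would split that side into at least two edges.
  The other side contributes a third edge, but the lens has only two.\<close>

lemma lens_side_has_no_vertex:
  assumes lens: "creates_lens F C D" and F: "C \<in> F" "D \<in> F" and "finite (arr_vertices F)"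
    and pos: "radius C > 0" "radius D > 0"
    and meet: "meet_properly C D" "circ C \<inter> circ D \<noteq> {}"
  shows "arr_vertices F \<inter> circ C \<inter> open_disc D = {}"
proof (rule ccontr)
  define V where "V = arr_vertices F"
  assume "arr_vertices F \<inter> circ C \<inter> open_disc D \<noteq> {}"
  then obtain m where m: "m \<in> V" "m \<in> circ C" "m \<in> open_disc D" by (auto simp: V_def)
  have "C \<noteq> D" and ne: "open_disc C \<inter> open_disc D \<noteq> {}"
    and card: "card (bounding_edges F (open_disc C \<inter> open_disc D)) = 2"
    using lens in_components_nonempty by (auto simp: creates_lens_def arr_faces_def)
  obtain p where p: "p \<in> circ C" "p \<in> circ D" using meet by blast
  have pV: "p \<in> V" using p F \<open>C \<noteq> D\<close> by (auto simp: V_def arr_vertices_def)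
  have "m \<noteq> p" using m p by (auto simp: disc_defs)
  \<comment> \<open>Removing the finitely many other vertices leaves a neighbourhood whose points,
    except its centre, are no vertices.\<close>
  have openV: "open (open_disc E - (V - {x}))" for E x
    using \<open>finite (arr_vertices F)\<close> by (intro open_Diff) (auto simp: open_disc_def V_def finite_imp_closed)
  have "m \<in> open_disc D - (V - {m})" using m by simp
  from circle_points_on_both_sides[OF m(2)[unfolded circ_def] p(1)[unfolded circ_def] \<open>m \<noteq> p\<close> openV this]
  obtain u v where "u \<in> circ C \<inter> (open_disc D - (V - {m}))" "v \<in> circ C \<inter> (open_disc D - (V - {m}))"
    and sides: "side m p u < 0" "side m p v > 0"
    unfolding circ_def .
  then have u: "u \<in> circ C" "u \<in> open_disc D - (V - {m})" "side m p u < 0"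
    and v: "v \<in> circ C" "v \<in> open_disc D - (V - {m})" "side m p v > 0"
    by simp_all
  have "side m p m = 0" by (simp add: side_def)
  then have uv: "u \<in> open_disc D" "u \<notin> V" "v \<in> open_disc D" "v \<notin> V" using u v by auto
  obtain w where w: "w \<in> circ D" "w \<in> open_disc C" "w \<notin> V"
  proof -
    obtain y where y: "y \<in> open_disc C" "y \<in> open_disc D" using ne by blast
    then have lt: "dist (center C) (center D) < radius C + radius D"
      using dist_triangle2[of "center C" "center D" y] by (auto simp: disc_defs dist_commute)
    define l where "l = norm (center C - center D)"
    have l: "dist (center C) (center D) = l" "l > 0"
      using meet(1) by (auto simp: l_def dist_norm meet_properly_def)
    \<comment> \<open>The point of \<open>D\<close> in the direction of the centre of
      \<open>C\<close>. It is inside \<open>C\<close> but may be a vertex, so a nearby point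
      \<open>w\<close> of \<open>D\<close> is taken instead.\<close>
    define q where "q = center D + (radius D / l) *\<^sub>R (center C - center D)"
    have q1: "q \<in> circ D" using pos l by (simp add: q_def circ_def dist_norm flip: l_def)
    have "center C - q = (1 - radius D / l) *\<^sub>R (center C - center D)"
      by (simp add: q_def algebra_simps)
    then have "dist (center C) q = \<bar>1 - radius D / l\<bar> * l" by (simp add: dist_norm l_def)
    also have "\<dots> = \<bar>(1 - radius D / l) * l\<bar>" using l by (simp add: abs_mult)
    also have "\<dots> = \<bar>l - radius D\<bar>" using l by (simp add: left_diff_distrib)
    finally have q2: "q \<in> open_disc C" using lt meet(1) l by (auto simp: meet_properly_def disc_defs)
    have "q \<noteq> p" using q2 p by (auto simp: disc_defs)
    have "q \<in> open_disc C - (V - {q})" using q2 by simp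
    from circle_points_on_both_sides[OF q1[unfolded circ_def] p(2)[unfolded circ_def] \<open>q \<noteq> p\<close> openV this]
    obtain w where "w \<in> circ D \<inter> (open_disc C - (V - {q}))" "side q p w < 0"
      unfolding circ_def .
    moreover have "side q p q = 0" by (simp add: side_def)
    ultimately show ?thesis using that by fastforce
  qed
  define e where "e E x = connected_component_set (circ E - V) x" for E x
  note eu = lens_edge[OF F \<open>C \<noteq> D\<close> u(1) uv(1) uv(2)[unfolded V_def] pos(1), folded V_def, folded e_def]
  note ev = lens_edge[OF F \<open>C \<noteq> D\<close> v(1) uv(3) uv(4)[unfolded V_def] pos(1), folded V_def, folded e_def]
  note ew = lens_edge[OF F(2,1) \<open>C \<noteq> D\<close>[symmetric] w(1,2) w(3)[unfolded V_def] pos(2), folded V_def,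
      folded e_def]
  \<comment> \<open>A connected edge containing \<open>u\<close> and \<open>v\<close> would meet the
    line through \<open>m\<close> and \<open>p\<close>, but on \<open>C\<close> this line has only
    the vertices \<open>m\<close> and \<open>p\<close>.\<close>
  have "e C u \<noteq> e C v"
  proof
    assume eq: "e C u = e C v"
    have "continuous_on (e C u) (side m p)" unfolding side_def by (intro continuous_intros)
    then have "connected (side m p ` e C u)" using eu(3) connected_continuous_image by blast
    moreover have "side m p u \<in> side m p ` e C u" "side m p v \<in> side m p ` e C u"
      using eu(2) ev(2) eq by auto
    ultimately have "0 \<in> side m p ` e C u" using u(3) v(3)
      by (meson connectedD_interval less_imp_le)
    then obtain x where x: "x \<in> e C u" "side m p x = 0" by auto
    then have "x = m \<or> x = p"
      using side_eq_0_on_sphere[of x "center C" "radius C" m p] eu(4) m p \<open>m \<noteq> p\<close>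
      by (auto simp: circ_def)
    then show False using x eu(4) m pV by blast
  qed
  moreover have "w \<notin> circ C" using w by (auto simp: disc_defs)
  then have "e D w \<noteq> e C u" "e D w \<noteq> e C v" using ew(2) eu(4) ev(4) by blast+
  ultimately have "card {e C u, e C v, e D w} = 3" by auto
  moreover have "{e C u, e C v, e D w} \<subseteq> bounding_edges F (open_disc C \<inter> open_disc D)"
    using eu(1) ev(1) ew(1) by (simp add: Int_commute)
  \<comment> \<open>An infinite set has \<open>card\<close> 0, so the value 2 gives
    finiteness.\<close>
  moreover have "finite (bounding_edges F (open_disc C \<inter> open_disc D))"
    using card by (metis card.infinite zero_neq_numeral)
  ultimately have "3 \<le> card (bounding_edges F (open_disc C \<inter> open_disc D))"
    by (metis card_mono)
  then show False using card by simp
qed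

lemma creates_lens_commute: "creates_lens F C D \<longleftrightarrow> creates_lens F D C"
  by (auto simp: creates_lens_def Int_commute)

text \<open>The lens is a face, so \<open>E\<close> misses its interior. Any point of
  \<open>E\<close> on \<open>C\<close> or \<open>D\<close> is a vertex, and the open sides contain
  none.\<close>

lemma uncut_lens:
  assumes lens: "creates_lens F C D" and F: "C \<in> F" "D \<in> F" "E \<in> F" "E \<noteq> C" "E \<noteq> D"
    and fin: "finite (arr_vertices F)"
    and pos: "radius C > 0" "radius D > 0"
    and meet: "meet_properly C D" "circ C \<inter> circ D \<noteq> {}"
  shows "uncut C D E"
proof -
  have "open_disc C \<inter> open_disc D \<in> components (- (\<Union>C\<in>F. circ C))"
    using lens by (auto simp: creates_lens_def arr_faces_def)
  then have "open_disc C \<inter> open_disc D \<subseteq> - circ E"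
    using in_components_subset[of "open_disc C \<inter> open_disc D"] F(3) by blast
  then have in_face: False if "x \<in> circ E" "x \<in> open_disc C" "x \<in> open_disc D" for x
    using that by blast
  have vert: "x \<in> arr_vertices F" if "x \<in> circ E" "x \<in> circ C \<or> x \<in> circ D" for x
    using F that unfolding arr_vertices_def by blast
  have on_C: False if "x \<in> circ E" "x \<in> circ C" "x \<in> open_disc D" for x
    using lens_side_has_no_vertex[OF lens F(1,2) fin pos meet] vert[of x] that by blast
  have "arr_vertices F \<inter> circ D \<inter> open_disc C = {}"
  proof (rule lens_side_has_no_vertex)
    show "creates_lens F D C" using lens by (simp only: creates_lens_commute)
    show "meet_properly D C" using meet(1) by (simp only: meet_properly_commute)
    show "circ D \<inter> circ C \<noteq> {}" using meet(2) by blast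
  qed (fact F fin pos)+
  then have on_D: False if "x \<in> circ E" "x \<in> circ D" "x \<in> open_disc C" for x
    using vert[of x] that by blast
  have closed: "x \<in> closed_disc X \<longleftrightarrow> x \<in> circ X \<or> x \<in> open_disc X" for x X
    by (auto simp: disc_defs)
  show ?thesis unfolding uncut_def
    using in_face on_C on_D closed by (metis (no_types, lifting) IntE equals0I)
qed

section \<open>Convex quadrilaterals\<close>

lemma edge_of_segment_extreme_points:
  assumes "closed_segment a b edge_of Q"
  shows "a extreme_point_of Q" "b extreme_point_of Q" "a \<noteq> b"
proof -
  have face: "closed_segment a b face_of Q" and dim: "aff_dim (closed_segment a b) = 1"
    using assms by (auto simp: edge_of_def)
  have "a extreme_point_of closed_segment a b" "b extreme_point_of closed_segment a b"
    by (simp_all add: extreme_point_of_segment)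
  then show "a extreme_point_of Q" "b extreme_point_of Q"
    using face extreme_point_of_face by blast+
  show "a \<noteq> b" using dim by auto
qed

lemma extreme_points_not_collinear:
  fixes x y w :: "'a::euclidean_space"
  assumes "x extreme_point_of Q" "y extreme_point_of Q" "w extreme_point_of Q"
    and "x \<noteq> y" "y \<noteq> w" "x \<noteq> w"
  shows "\<not> collinear {x, y, w}"
proof
  assume "collinear {x, y, w}"
  then have "x \<in> closed_segment y w \<or> y \<in> closed_segment w x \<or> w \<in> closed_segment x y"
    unfolding collinear_between_cases between_mem_segment by blast
  then have "x \<in> open_segment y w \<or> y \<in> open_segment w x \<or> w \<in> open_segment x y"
    using assms by (auto simp: open_segment_def)
  then show False using assms(1-3) unfolding extreme_point_of_def by blast
qed

text \<open>The crossing comes from a Radon partition of the four corners. Extremality excludes a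
  part with one point, disjointness excludes the partition into the two given edges, and the other
  two partitions are the stated crossings.\<close>

lemma avoiding_segments:
  assumes Q: "convex_quadrilateral Q" "opposite_edges Q (closed_segment a b) (closed_segment c d)"
  shows "Q = convex hull {a, b, c, d}"
    and "{v. v extreme_point_of Q} = {a, b, c, d}" and "card {a, b, c, d} = 4"
    and "closed_segment a c \<inter> closed_segment b d \<noteq> {} \<or> closed_segment a d \<inter> closed_segment b c \<noteq> {}"
proof -
  let ?V = "{a, b, c, d}"
  have poly: "polytope Q" and c4: "card {v. v extreme_point_of Q} = 4"
    using Q by (auto simp: convex_quadrilateral_def)
  have disj: "closed_segment a b \<inter> closed_segment c d = {}"
    and ab: "closed_segment a b edge_of Q" and cd: "closed_segment c d edge_of Q"
    using Q by (auto simp: opposite_edges_def)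
  note ext = edge_of_segment_extreme_points[OF ab] edge_of_segment_extreme_points[OF cd]
  have dist: "a \<noteq> c" "a \<noteq> d" "b \<noteq> c" "b \<noteq> d" using disj by auto
  show cV: "card ?V = 4" using dist ext by simp
  have "finite {v. v extreme_point_of Q}" using c4 by (metis card.infinite zero_neq_numeral)
  then show V: "{v. v extreme_point_of Q} = ?V"
    using card_subset_eq[of "{v. v extreme_point_of Q}" ?V] cV c4 ext by auto
  show hull: "Q = convex hull ?V"
    using Krein_Milman_Minkowski[of Q] poly V polytope_imp_compact polytope_imp_convex by metis
  \<comment> \<open>Otherwise \<open>x\<close> could be dropped from the hull, but extreme points of
    a hull belong to every generating set.\<close>
  have notin: "x \<notin> convex hull (?V - {x})" if "x \<in> ?V" for x
  proof
    assume "x \<in> convex hull (?V - {x})"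
    then have "convex hull ?V = convex hull (?V - {x})"
      using that by (metis hull_redundant insert_Diff)
    then have "x extreme_point_of convex hull (?V - {x})" using V hull that by (metis mem_Collect_eq)
    then show False using extreme_point_of_convex_hull by blast
  qed
  \<comment> \<open>Four points in the plane are always affinely dependent.\<close>
  have "affine_dependent ?V"
    by (rule affine_dependent_biggerset) (use cV in simp_all)
  then obtain M P where MP: "a \<in> M" "M \<inter> P = {}" "M \<union> P = ?V" "convex hull M \<inter> convex hull P \<noteq> {}"
    using Radon_partition[of ?V] by (metis Int_commute UnE Un_commute finite.emptyI finite_insert insertI1)
  have M: "M \<noteq> {a}"
  proof
    assume "M = {a}"
    moreover from this have "P = ?V - {a}" using MP by blast
    ultimately show False using MP(4) notin[of a] by auto
  qed
  have P: "\<not> P \<subseteq> {x}" if "x \<in> {b, c, d}" for x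
  proof
    assume P: "P \<subseteq> {x}"
    have "P \<noteq> {}" using MP(4) by auto
    then have "P = {x}" using P by blast
    moreover from this have "M = ?V - {x}" using MP by blast
    ultimately show False using MP(4) notin[of x] that by auto
  qed
  have P_eq: "P = ?V - M" using MP by blast
  have M_sub: "M \<subseteq> ?V" using MP by blast
  have "b \<notin> M \<or> c \<notin> M \<and> d \<notin> M" "c \<notin> M \<or> d \<notin> M"
    using P[of b] P[of c] P[of d] MP(1) unfolding P_eq by blast+
  moreover have "b \<in> M \<or> c \<in> M \<or> d \<in> M" using M MP(1) M_sub by blast
  ultimately consider "M = {a, b}" | "M = {a, c}" | "M = {a, d}" using MP(1) M_sub by blast
  then show "closed_segment a c \<inter> closed_segment b d \<noteq> {} \<or> closed_segment a d \<inter> closed_segment b c \<noteq> {}"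
  proof cases
    case 1
    then have "P = {c, d}" using P_eq dist ext by auto
    then show ?thesis using 1 MP(4) disj by (simp add: segment_convex_hull)
  next
    case 2
    then have "P = {b, d}" using P_eq dist ext by auto
    then show ?thesis using 2 MP(4) by (simp add: segment_convex_hull)
  next
    case 3
    then have "P = {b, c}" using P_eq dist ext by auto
    then show ?thesis using 3 MP(4) by (simp add: segment_convex_hull)
  qed
qed

section \<open>Avoiding edges\<close>

text \<open>Both colours enter the crossing argument only through \<open>uncut\<close>, so they are
  treated together until tangency is excluded.\<close>

definition linked :: "circle set \<Rightarrow> circle \<Rightarrow> circle \<Rightarrow> bool" where
  "linked F C D \<longleftrightarrow> C \<in> F \<and> D \<in> F \<and> (creates_lens F C D \<or> touch C D)"

lemma linked_commute: "linked F C D \<longleftrightarrow> linked F D C"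
  by (auto simp: linked_def creates_lens_commute touch_def touch_at_def Int_commute)

locale pairwise_intersecting_circles =
  fixes F :: "circle set"
  assumes fin: "finite F"
    and pos: "C \<in> F \<Longrightarrow> radius C > 0"
    and intersect: "C \<in> F \<Longrightarrow> D \<in> F \<Longrightarrow> C \<noteq> D \<Longrightarrow> circ C \<inter> circ D \<noteq> {}"
    and no_containment: "C \<in> F \<Longrightarrow> D \<in> F \<Longrightarrow> C \<noteq> D \<Longrightarrow> \<not> closed_disc C \<subseteq> closed_disc D"
begin

lemma meet_properly:
  assumes "C \<in> F" "D \<in> F" "C \<noteq> D"
  shows "meet_properly C D"
proof -
  obtain p where "p \<in> circ C" "p \<in> circ D" using intersect assms by blast
  then have "dist (center C) (center D) \<le> radius C + radius D"
    using dist_triangle2[of "center C" "center D" p] by (simp add: circ_def)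
  moreover have "\<not> dist (center C) (center D) + radius C \<le> radius D"
    using no_containment[OF assms] by (simp add: closed_disc_def cball_subset_cball_iff)
  moreover have "\<not> dist (center D) (center C) + radius D \<le> radius C"
    using no_containment[of D C] assms by (simp add: closed_disc_def cball_subset_cball_iff)
  ultimately show ?thesis by (auto simp: meet_properly_def dist_commute)
qed

lemma finite_arr_vertices: "finite (arr_vertices F)"
proof -
  have "center C \<noteq> center D" if "C \<in> F" "D \<in> F - {C}" for C D
    using meet_properly[of C D] that by (auto simp: meet_properly_def)
  then show ?thesis unfolding arr_vertices_def using fin by (intro finite_UN_I finite_circ_Int_circ) auto
qed

lemma uncut_linked:
  assumes "linked F C D" "E \<in> F" "E \<noteq> C" "E \<noteq> D"
  shows "uncut C D E"
proof -
  have F: "C \<in> F" "D \<in> F" "C \<noteq> D"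
    using assms(1) by (auto simp: linked_def creates_lens_def touch_def touch_at_def)
  then show ?thesis
    using assms uncut_lens[OF _ F(1,2) assms(2-4) finite_arr_vertices]
      uncut_if_dist[OF touch_dist[of C D]] pos meet_properly intersect
    unfolding linked_def by blast
qed

text \<open>Once \<open>z\<close> lies on all four circles, it is between the centres of each
  diagonal pair, so these pairs touch there. If the circles of an edge touched, \<open>z\<close>
  would lie on that edge too, against non-collinearity.\<close>

lemma crossing_diagonals_imp_touching:
  assumes link: "linked F A B" "linked F C D"
    and z: "z \<in> closed_segment (center A) (center C)" "z \<in> closed_segment (center B) (center D)"
    and ncol: "\<not> collinear {center A, center B, center C}" "\<not> collinear {center A, center B, center D}"
      "\<not> collinear {center A, center C, center D}" "\<not> collinear {center B, center C, center D}"
  shows "touching_quadruple F A B C D" "\<not> touch A B" "\<not> touch C D"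
proof -
  have F: "A \<in> F" "B \<in> F" "C \<in> F" "D \<in> F" using link by (auto simp: linked_def)
  have dist: "A \<noteq> B" "A \<noteq> C" "A \<noteq> D" "B \<noteq> C" "B \<noteq> D" "C \<noteq> D"
    using ncol by (auto simp: insert_commute)
  have z': "z \<in> closed_segment (center C) (center A)" "z \<in> closed_segment (center D) (center B)"
    using z by (simp_all add: closed_segment_commute)
  have "collinear {center B, z, center D}"
    using z(2) by (metis between_imp_collinear between_mem_segment)
  \<comment> \<open>If \<open>z\<close> were a centre of the first diagonal, that centre would be
    collinear with those of \<open>B\<close> and \<open>D\<close>.\<close>
  then have ne: "z \<noteq> center A" "z \<noteq> center C" using ncol by (auto simp: insert_commute)
  have "\<not> collinear {center A, center D, center C}" "\<not> collinear {center C, center B, center A}"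
    "\<not> collinear {center C, center D, center A}"
    using ncol by (simp_all add: insert_commute)
  with ncol(1) have nc: "\<not> collinear {center A, center B, z}" "\<not> collinear {center A, center D, z}"
      "\<not> collinear {center C, center B, z}" "\<not> collinear {center C, center D, z}"
    using collinear_segment_ends[OF _ z(1) ne(1)] collinear_segment_ends[OF _ z'(1) ne(2)]
    by blast+
  have on: "z \<in> circ A \<inter> circ B \<inter> circ C \<inter> circ D"
    by (rule diagonals_meet_on_circles)
      (use F dist meet_properly pos uncut_linked link z nc in \<open>auto\<close>)
  have "touch_at A C z" "touch_at B D z" using touch_atI dist on z by blast+
  then show "touching_quadruple F A B C D"
    using F dist on by (auto simp: touching_quadruple_def)
  have not_touch: "\<not> touch X Y"
    if "X \<in> F" "Y \<in> F" "X \<noteq> Y" "z \<in> circ X" "z \<in> circ Y" "\<not> collinear {center X, center Y, z}" for X Y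
  proof
    assume "touch X Y"
    then have "dist (center X) (center Y) = radius X + radius Y"
      using touch_dist meet_properly pos that by blast
    then have "z \<in> closed_segment (center X) (center Y)"
      using that by (simp add: in_closed_segment_dist circ_def dist_commute)
    then have "collinear {center X, z, center Y}" by (metis between_imp_collinear between_mem_segment)
    then show False using that(6) by (simp add: insert_commute)
  qed
  show "\<not> touch A B" "\<not> touch C D" using not_touch F dist on nc by blast+
qed

lemma avoiding_imp_touching_quadruple:
  assumes link: "linked F A B" "linked F C D"
    and Q: "convex_quadrilateral Q"
      "opposite_edges Q (closed_segment (center A) (center B)) (closed_segment (center C) (center D))"
  obtains C1 C2 C3 C4 where "touching_quadruple F C1 C2 C3 C4"
    "Q = convex hull {center C1, center C2, center C3, center C4}" "\<not> touch A B" "\<not> touch C D"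
proof -
  let ?a = "center A" and ?b = "center B" and ?c = "center C" and ?d = "center D"
  note av = avoiding_segments[OF Q]
  have "x extreme_point_of Q" if "x \<in> {?a, ?b, ?c, ?d}" for x using av(2) that by blast
  moreover have "?a \<noteq> ?b" "?a \<noteq> ?c" "?a \<noteq> ?d" "?b \<noteq> ?c" "?b \<noteq> ?d" "?c \<noteq> ?d"
    using av(3) by (auto simp: card_insert_if split: if_splits)
  ultimately have ncol: "\<not> collinear {?a, ?b, ?c}" "\<not> collinear {?a, ?b, ?d}"
    "\<not> collinear {?a, ?c, ?d}" "\<not> collinear {?b, ?c, ?d}"
    by (meson extreme_points_not_collinear insertCI)+
  consider z where "z \<in> closed_segment ?a ?c" "z \<in> closed_segment ?b ?d"
    | z where "z \<in> closed_segment ?a ?d" "z \<in> closed_segment ?b ?c"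
    using av(4) by blast
  then show ?thesis
  proof cases
    case 1
    then show ?thesis
      using crossing_diagonals_imp_touching[OF link 1 ncol] that[of A B C D] av(1) by blast
  next
    case 2
    \<comment> \<open>The ends of the second edge come in no particular order; exchanging
      \<open>C\<close> and \<open>D\<close> reduces this case to the first.\<close>
    have "linked F D C" using link(2) by (simp add: linked_commute)
    from crossing_diagonals_imp_touching[OF link(1) this 2] ncol
    have "touching_quadruple F A B D C" "\<not> touch A B" "\<not> touch D C"
      by (simp_all add: insert_commute)
    then show ?thesis
      using that[of A B D C] av(1)
      by (auto simp: insert_commute touch_def touch_at_def Int_commute)
  qed
qed

text \<open>The last alternative is how an edge is later shown to be red: it suffices to exclude
  that its two circles touch.\<close>

lemma graph_edge_cases:
  assumes "s \<in> graph_edges F"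
  obtains A B where "linked F A B" "s = closed_segment (center A) (center B)" "touch A B \<or> s \<in> red_edges F"
  using assms unfolding graph_edges_def red_edges_def blue_edges_def linked_def by blast

end

theorem theorem4:
  fixes F :: "circle set"
  assumes "finite F"
    and "\<forall>C\<in>F. radius C > 0"
    and "\<forall>C\<in>F. \<forall>D\<in>F. C \<noteq> D \<longrightarrow> circ C \<inter> circ D \<noteq> {}"
    and "\<forall>C\<in>F. \<forall>D\<in>F. C \<noteq> D \<longrightarrow> \<not> closed_disc C \<subseteq> closed_disc D"
  shows "((\<nexists>C1 C2 C3 C4. touching_quadruple F C1 C2 C3 C4) \<longrightarrow>
            \<not> (\<exists>s\<in>graph_edges F. \<exists>t\<in>graph_edges F. avoiding s t)) \<and>
         (\<forall>s\<in>graph_edges F. \<forall>t\<in>graph_edges F. avoiding s t \<longrightarrow>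
            s \<in> red_edges F \<and> t \<in> red_edges F \<and>
            (\<exists>C1 C2 C3 C4. touching_quadruple F C1 C2 C3 C4 \<and>
               (let Q = convex hull {center C1, center C2, center C3, center C4}
                in convex_quadrilateral Q \<and> opposite_edges Q s t)))"
proof -
  interpret pairwise_intersecting_circles F
    using assms by unfold_locales auto
  have "s \<in> red_edges F \<and> t \<in> red_edges F \<and>
            (\<exists>C1 C2 C3 C4. touching_quadruple F C1 C2 C3 C4 \<and>
               (let Q = convex hull {center C1, center C2, center C3, center C4}
                in convex_quadrilateral Q \<and> opposite_edges Q s t))"
    if s: "s \<in> graph_edges F" and t: "t \<in> graph_edges F" and "avoiding s t" for s t
  proof -
    obtain Q where Q: "convex_quadrilateral Q" "opposite_edges Q s t"
      using \<open>avoiding s t\<close> by (auto simp: avoiding_def)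
    obtain A B where AB: "linked F A B" "s = closed_segment (center A) (center B)"
      "touch A B \<or> s \<in> red_edges F" using s by (rule graph_edge_cases)
    obtain C D where CD: "linked F C D" "t = closed_segment (center C) (center D)"
      "touch C D \<or> t \<in> red_edges F" using t by (rule graph_edge_cases)
    obtain C1 C2 C3 C4 where "touching_quadruple F C1 C2 C3 C4"
      "Q = convex hull {center C1, center C2, center C3, center C4}" "\<not> touch A B" "\<not> touch C D"
      using avoiding_imp_touching_quadruple[OF AB(1) CD(1) Q(1) Q(2)[unfolded AB(2) CD(2)]] .
    then show ?thesis using AB(3) CD(3) Q unfolding Let_def by blast
  qed
  \<comment> \<open>The first half of the claim follows from the second, which supplies a quadruple
    for every avoiding pair.\<close>
  then show ?thesis by blast
qed

end
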